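(* Let $n\geq 3$ and let $t$ be the $n$-dimensional tarai function on $\mathbb{Z}^n$. For every $\vec{x}\in\mathbb{Z}^n$, the evaluation of $t(\vec{x})$ terminates with call-by-need, and $t(\vec{x})\leq\max(\vec{x})$, where $\max(\vec{x})=\max\{\vec{x}(1),\ldots,\vec{x}(n)\}$.
   Context: For $\vec{x}=\langle x_1,\ldots,x_n\rangle\in\mathbb{Z}^n$ write $\vec{x}(i)=x_i$, $\sigma(\vec{x})=\langle x_1-1,x_2,\ldots,x_n\rangle$ and $r(\vec{x})=\langle x_2,x_3,\ldots,x_n,x_1\rangle$. The $n$-dimensional tarai function $t$ is defined by the recursion: if $\vec{x}(1)\leq\vec{x}(2)$ then $t(\vec{x})=\vec{x}(2)$; otherwise $t(\vec{x})=t(\vec{y})$ where $\vec{y}(i)=t(\sigma(r^{i-1}(\vec{x})))$ for $i=1,\ldots,n$. Evaluation with call-by-need means: the arguments $\vec{y}(i)$ of the outer call are passed unevaluated (as delayed computations), and each is evaluated (at most once) only when its value is actually needed by the computation (e.g. compared in the test $\vec{y}(1)\leq\vec{y}(2)$ or returned); arguments whose values are never needed are never evaluated. "Terminates" means this evaluation process is finite. *)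

theory Defs
  imports Main
begin

text \<open>
  Call-by-need evaluation of a single recursion equation \<open>t(x\<^sub>1,\<dots>,x\<^sub>n) = body\<close> over the integers,
  as a big-step semantics with a heap in the style of Launchbury. \<open>Var i\<close> is the formal parameter
  with index \<open>i\<close> (counted from 0), \<open>Call es\<close> is a call of \<open>t\<close> itself.
\<close>

datatype expr =
    Num int
  | Var nat
  | Dec expr
  | IfLe expr expr expr expr
  | Call "expr list"

text \<open>
  A heap cell holds either a delayed computation (an expression together with the heap addresses
  of its parameters) or, once it has been forced, its value.
\<close>

datatype cell = Evaluated int | Delayed expr "nat list"

text \<open>
  \<open>need_eval body H \<rho> e H' v\<close>: evaluating \<open>e\<close> with parameter addresses \<open>\<rho>\<close> in heap \<open>H\<close> is finite and
  results in the value \<open>v\<close> and the heap \<open>H'\<close>. Calls append their arguments to the heap unevaluated;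
  forcing a delayed cell overwrites it, so that no cell is computed twice. Delayed expressions
  refer only to older cells, so the heap has no cycles.
\<close>

inductive need_eval :: "expr \<Rightarrow> cell list \<Rightarrow> nat list \<Rightarrow> expr \<Rightarrow> cell list \<Rightarrow> int \<Rightarrow> bool"
  for body :: expr
where
  Num: "need_eval body H \<rho> (Num k) H k"
| Var_evaluated:
    "\<lbrakk>i < length \<rho>; \<rho> ! i < length H; H ! (\<rho> ! i) = Evaluated v\<rbrakk>
      \<Longrightarrow> need_eval body H \<rho> (Var i) H v"
| Var_delayed:
    "\<lbrakk>i < length \<rho>; \<rho> ! i < length H; H ! (\<rho> ! i) = Delayed e \<rho>'; need_eval body H \<rho>' e H' v\<rbrakk>
      \<Longrightarrow> need_eval body H \<rho> (Var i) (H'[\<rho> ! i := Evaluated v]) v"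
| Dec: "need_eval body H \<rho> e H' v \<Longrightarrow> need_eval body H \<rho> (Dec e) H' (v - 1)"
| IfLe_true:
    "\<lbrakk>need_eval body H \<rho> a H\<^sub>1 u; need_eval body H\<^sub>1 \<rho> b H\<^sub>2 w; u \<le> w; need_eval body H\<^sub>2 \<rho> c H' v\<rbrakk>
      \<Longrightarrow> need_eval body H \<rho> (IfLe a b c d) H' v"
| IfLe_false:
    "\<lbrakk>need_eval body H \<rho> a H\<^sub>1 u; need_eval body H\<^sub>1 \<rho> b H\<^sub>2 w; \<not> u \<le> w; need_eval body H\<^sub>2 \<rho> d H' v\<rbrakk>
      \<Longrightarrow> need_eval body H \<rho> (IfLe a b c d) H' v"
| Call:
    "need_eval body (H @ map (\<lambda>e. Delayed e \<rho>) es) [length H..<length H + length es] body H' v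
      \<Longrightarrow> need_eval body H \<rho> (Call es) H' v"

inductive_cases need_eval_NumE: "need_eval body H \<rho> (Num k) H' v"
inductive_cases need_eval_VarE: "need_eval body H \<rho> (Var i) H' v"
inductive_cases need_eval_DecE: "need_eval body H \<rho> (Dec e) H' v"
inductive_cases need_eval_IfLeE: "need_eval body H \<rho> (IfLe a b c d) H' v"
inductive_cases need_eval_CallE: "need_eval body H \<rho> (Call es) H' v"

lemma need_eval_deterministic:
  "need_eval body H \<rho> e H\<^sub>1 v\<^sub>1 \<Longrightarrow> need_eval body H \<rho> e H\<^sub>2 v\<^sub>2 \<Longrightarrow> H\<^sub>1 = H\<^sub>2 \<and> v\<^sub>1 = v\<^sub>2"
proof (induction arbitrary: H\<^sub>2 v\<^sub>2 rule: need_eval.induct)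
  case (Num H \<rho> k)
  then show ?case by (auto elim: need_eval_NumE)
next
  case (Var_evaluated i \<rho> H v)
  then show ?case by (auto elim: need_eval_VarE)
next
  case (Var_delayed i \<rho> H e \<rho>' H' v)
  from Var_delayed.prems Var_delayed.hyps(3) show ?case
    by (cases rule: need_eval_VarE) (auto dest: Var_delayed.IH)
next
  case (Dec H \<rho> e H' v)
  from Dec.prems show ?case
    by (cases rule: need_eval_DecE) (auto dest: Dec.IH)
next
  case (IfLe_true H \<rho> a H\<^sub>1 u b H\<^sub>2' w c H' v d)
  from IfLe_true.prems show ?case
    by (cases rule: need_eval_IfLeE) (use IfLe_true.IH IfLe_true.hyps in blast)+
next
  case (IfLe_false H \<rho> a H\<^sub>1 u b H\<^sub>2' w d H' v c)
  from IfLe_false.prems show ?case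
    by (cases rule: need_eval_IfLeE) (use IfLe_false.IH IfLe_false.hyps in blast)+
next
  case (Call H \<rho> es H' v)
  from Call.prems show ?case
    by (cases rule: need_eval_CallE) (auto dest: Call.IH)
qed

fun sigma :: "expr list \<Rightarrow> expr list" where
  "sigma [] = []"
| "sigma (e # es) = Dec e # es"

definition tarai_body :: "nat \<Rightarrow> expr" where
  "tarai_body n =
    (let x = map Var [0..<n] in
      IfLe (x ! 0) (x ! 1) (x ! 1)
        (Call (map (\<lambda>i. Call (sigma ((rotate1 ^^ (i - 1)) x))) [1..<n + 1])))"

definition tarai_evaluates_to :: "nat \<Rightarrow> int list \<Rightarrow> int \<Rightarrow> bool" where
  "tarai_evaluates_to n x v \<longleftrightarrow> (\<exists>H. need_eval (tarai_body n) [] [] (Call (map Num x)) H v)"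

definition tarai_terminates :: "nat \<Rightarrow> int list \<Rightarrow> bool" where
  "tarai_terminates n x \<longleftrightarrow> (\<exists>v. tarai_evaluates_to n x v)"

lemma tarai_evaluates_to_unique:
  "tarai_evaluates_to n x v \<Longrightarrow> tarai_evaluates_to n x w \<Longrightarrow> v = w"
  unfolding tarai_evaluates_to_def using need_eval_deterministic by blast

definition tarai :: "nat \<Rightarrow> int list \<Rightarrow> int" where
  "tarai n x = (THE v. tarai_evaluates_to n x v)"

lemma tarai_eqI: "tarai_evaluates_to n x v \<Longrightarrow> tarai n x = v"
  unfolding tarai_def by (blast intro: tarai_evaluates_to_unique)

end

theory Submission imports Defs begin

text \<open>
  Call-by-need evaluation is finite as soon as call-by-name evaluation is, so it suffices to bound
  the latter. Let \<open>M\<close> be the maximum of the arguments, and suppose first that it occurs at position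
  \<open>k \<ge> 2\<close>. If \<open>x\<^sub>1 > x\<^sub>2\<close>, then for \<open>1 < i < k\<close> the argument \<open>y\<^sub>i\<close> of the outer call is itself a
  call with \<open>M\<close> at position \<open>k - i + 1\<close>, and \<open>y\<^bsub>k-1\<^esub> = M\<close> because \<open>x\<^bsub>k-1\<^esub> - 1 \<le> M\<close>. Hence the outer
  call has its maximum \<open>M\<close> at position \<open>k - 1\<close>, and induction on \<open>k\<close> (and, for \<open>y\<^sub>1\<close>, on \<open>x\<^sub>1 - x\<^sub>2\<close>)
  shows that the value exists, is at most \<open>M\<close> and does not depend on the arguments after position
  \<open>k\<close>, which may therefore diverge. If \<open>M\<close> occurs only at position 1, then \<open>y\<^sub>n = M\<close>, while
  \<open>y\<^sub>1 \<le> M\<close> by induction on \<open>x\<^sub>1 - x\<^sub>2\<close>, so the outer call falls under the first case.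
\<close>

section \<open>Call-by-name evaluation\<close>

text \<open>Addresses are replaced by finite trees of closures: nothing is overwritten, so no heap
  has to be threaded through an evaluation.\<close>

datatype thunk = Thunk (code: expr) (env: "thunk list")

inductive name_eval :: "expr \<Rightarrow> thunk list \<Rightarrow> expr \<Rightarrow> int \<Rightarrow> bool" for body :: expr where
  Num: "name_eval body E (Num k) k"
| Var: "\<lbrakk>i < length E; E ! i = Thunk e E'; name_eval body E' e v\<rbrakk> \<Longrightarrow> name_eval body E (Var i) v"
| Dec: "name_eval body E e v \<Longrightarrow> name_eval body E (Dec e) (v - 1)"
| IfLe_true: "\<lbrakk>name_eval body E a u; name_eval body E b w; u \<le> w; name_eval body E c v\<rbrakk>
    \<Longrightarrow> name_eval body E (IfLe a b c d) v"
| IfLe_false: "\<lbrakk>name_eval body E a u; name_eval body E b w; \<not> u \<le> w; name_eval body E d v\<rbrakk>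
    \<Longrightarrow> name_eval body E (IfLe a b c d) v"
| Call: "name_eval body (map (\<lambda>e. Thunk e E) es) body v \<Longrightarrow> name_eval body E (Call es) v"

inductive_cases name_eval_NumE: "name_eval body E (Num k) v"
inductive_cases name_eval_VarE: "name_eval body E (Var i) v"
inductive_cases name_eval_DecE: "name_eval body E (Dec e) v"
inductive_cases name_eval_IfLeE: "name_eval body E (IfLe a b c d) v"
inductive_cases name_eval_CallE: "name_eval body E (Call es) v"

lemma name_eval_deterministic:
  "name_eval body E e v \<Longrightarrow> name_eval body E e w \<Longrightarrow> v = w"
proof (induction arbitrary: w rule: name_eval.induct)
  case (Num E k)
  then show ?case by (auto elim: name_eval_NumE)
next
  case (Var i E e E' v)
  from Var.prems show ?case
    by (rule name_eval_VarE) (metis Var.hyps(2) Var.IH thunk.inject)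
next
  case (Dec E e v)
  from Dec.prems show ?case
    by (rule name_eval_DecE) (auto dest: Dec.IH)
next
  case (IfLe_true E a u b w' c v d)
  from IfLe_true.prems show ?case
    by (rule name_eval_IfLeE) (use IfLe_true.IH IfLe_true.hyps in blast)+
next
  case (IfLe_false E a u b w' d v c)
  from IfLe_false.prems show ?case
    by (rule name_eval_IfLeE) (use IfLe_false.IH IfLe_false.hyps in blast)+
next
  case (Call E es v)
  from Call.prems show ?case
    by (rule name_eval_CallE) (auto dest: Call.IH)
qed

definition forces :: "expr \<Rightarrow> thunk \<Rightarrow> int \<Rightarrow> bool" where
  "forces body th v \<longleftrightarrow> name_eval body (env th) (code th) v"

lemma forces_Thunk [simp]: "forces body (Thunk e E) v \<longleftrightarrow> name_eval body E e v"
  by (simp add: forces_def)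

lemma name_eval_Var:
  "i < length E \<Longrightarrow> forces body (E ! i) v \<Longrightarrow> name_eval body E (Var i) v"
  by (cases "E ! i") (auto intro: name_eval.Var)

section \<open>Call-by-need evaluation simulates call-by-name evaluation\<close>

text \<open>An evaluated cell no longer holds its code, so only its value can be compared with the
  thunk.\<close>

definition cell_unfolds :: "expr \<Rightarrow> thunk list \<Rightarrow> cell \<Rightarrow> thunk \<Rightarrow> bool" where
  "cell_unfolds body T c th \<longleftrightarrow> (case c of
     Evaluated v \<Rightarrow> forces body th v
   | Delayed e \<rho> \<Rightarrow> set \<rho> \<subseteq> {..<length T} \<and> th = Thunk e (map ((!) T) \<rho>))"

text \<open>
  \<open>T\<close> records, for every address, the thunk that was originally stored there, with addresses
  unfolded into trees; overwriting a cell with its value leaves \<open>T\<close> unchanged.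
\<close>

definition heap_unfolds :: "expr \<Rightarrow> cell list \<Rightarrow> thunk list \<Rightarrow> bool" where
  "heap_unfolds body H T \<longleftrightarrow> list_all2 (cell_unfolds body T) H T"

lemma map_nth_append:
  "set \<rho> \<subseteq> {..<length T} \<Longrightarrow> map ((!) (T @ T')) \<rho> = map ((!) T) \<rho>"
  by (auto simp: nth_append)

lemma cell_unfolds_append:
  assumes "cell_unfolds body T c th"
  shows "cell_unfolds body (T @ T') c th"
proof (cases c)
  case (Delayed e \<rho>)
  with assms show ?thesis
    by (fastforce simp: cell_unfolds_def map_nth_append)
qed (use assms in \<open>simp add: cell_unfolds_def\<close>)

lemma heap_unfolds_alloc:
  assumes "heap_unfolds body H T" "set \<rho> \<subseteq> {..<length T}"
  shows "heap_unfolds body (H @ map (\<lambda>e. Delayed e \<rho>) es)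
           (T @ map (\<lambda>e. Thunk e (map ((!) T) \<rho>)) es)"
proof -
  let ?T' = "map (\<lambda>e. Thunk e (map ((!) T) \<rho>)) es"
  have "list_all2 (cell_unfolds body (T @ ?T')) H T"
    using assms(1) unfolding heap_unfolds_def
    by (rule list_all2_mono) (rule cell_unfolds_append)
  moreover have "list_all2 (cell_unfolds body (T @ ?T')) (map (\<lambda>e. Delayed e \<rho>) es) ?T'"
    using assms(2) by (fastforce simp: list_all2_conv_all_nth cell_unfolds_def map_nth_append)
  ultimately show ?thesis
    unfolding heap_unfolds_def by (rule list_all2_appendI)
qed

lemma heap_unfolds_update:
  assumes "heap_unfolds body H T" "a < length T" "forces body (T ! a) v"
  shows "heap_unfolds body (H[a := Evaluated v]) T"
  using assms unfolding heap_unfolds_def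
  by (auto simp: list_all2_conv_all_nth nth_list_update cell_unfolds_def)

text \<open>By induction on the call-by-name derivation. \<open>T\<close> grows only at its end, so
  the addresses in \<open>\<rho>\<close> denote the same thunks throughout.\<close>

theorem need_eval_if_name_eval:
  assumes "name_eval body E e v" "heap_unfolds body H T"
    and "set \<rho> \<subseteq> {..<length T}" "E = map ((!) T) \<rho>"
  shows "\<exists>H' T'. need_eval body H \<rho> e H' v \<and> heap_unfolds body H' (T @ T')"
  using assms
proof (induction arbitrary: H T \<rho> rule: name_eval.induct)
  case (Num E k)
  then show ?case
    by (metis need_eval.Num append_Nil2)
next
  case (Var i E e E' v)
  let ?a = "\<rho> ! i"
  have i: "i < length \<rho>" "?a < length T" and Ta: "T ! ?a = Thunk e E'"
    using Var.hyps Var.prems by (auto simp: subset_iff)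
  have len: "length H = length T"
    using Var.prems(1) by (auto simp: heap_unfolds_def dest: list_all2_lengthD)
  have cell: "cell_unfolds body T (H ! ?a) (Thunk e E')"
    using Var.prems(1) i(2) len Ta unfolding heap_unfolds_def by (metis list_all2_nthD)
  show ?case
  proof (cases "H ! ?a")
    case (Evaluated w)
    \<comment> \<open>The cached value is one that the thunk has under call-by-name, and determinism
      identifies it with \<open>v\<close>.\<close>
    with cell have "name_eval body E' e w" by (simp add: cell_unfolds_def)
    with Var.hyps have "w = v" by (blast dest: name_eval_deterministic)
    with Evaluated i len have "need_eval body H \<rho> (Var i) H v"
      by (simp add: need_eval.Var_evaluated)
    with Var.prems(1) show ?thesis by (metis append_Nil2)
  next
    case (Delayed e' \<rho>')
    with cell have "e' = e" "set \<rho>' \<subseteq> {..<length T}" "E' = map ((!) T) \<rho>'"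
      by (auto simp: cell_unfolds_def)
    with Var.IH Var.prems(1) obtain H' T'
      where H': "need_eval body H \<rho>' e H' v" "heap_unfolds body H' (T @ T')" by blast
    have "need_eval body H \<rho> (Var i) (H'[?a := Evaluated v]) v"
      using Delayed \<open>e' = e\<close> i len H'(1) by (simp add: need_eval.Var_delayed)
    moreover have "heap_unfolds body (H'[?a := Evaluated v]) (T @ T')"
      using H'(2) i Ta Var.hyps by (intro heap_unfolds_update) (auto simp: nth_append)
    ultimately show ?thesis by blast
  qed
next
  case (Dec E e v)
  then show ?case
    by (metis need_eval.Dec)
next
  case (IfLe_true E a u b w c v d)
  obtain H1 T1 where 1: "need_eval body H \<rho> a H1 u" "heap_unfolds body H1 (T @ T1)"
    using IfLe_true.IH(1) IfLe_true.prems by blast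
  have T1: "set \<rho> \<subseteq> {..<length (T @ T1)}" "E = map ((!) (T @ T1)) \<rho>"
    using IfLe_true.prems by (auto simp: map_nth_append)
  obtain H2 T2 where 2: "need_eval body H1 \<rho> b H2 w" "heap_unfolds body H2 ((T @ T1) @ T2)"
    using IfLe_true.IH(2)[OF 1(2) T1] by blast
  have T2: "set \<rho> \<subseteq> {..<length ((T @ T1) @ T2)}" "E = map ((!) ((T @ T1) @ T2)) \<rho>"
    using T1(1) T1(2) map_nth_append[OF T1(1), of T2] by (simp_all only: length_append) auto
  obtain H3 T3 where 3: "need_eval body H2 \<rho> c H3 v" "heap_unfolds body H3 (((T @ T1) @ T2) @ T3)"
    using IfLe_true.IH(3)[OF 2(2) T2] by blast
  show ?case
    using need_eval.IfLe_true[OF 1(1) 2(1) IfLe_true.hyps(3) 3(1)] 3(2) by (metis append_assoc)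
next
  case (IfLe_false E a u b w d v c)
  obtain H1 T1 where 1: "need_eval body H \<rho> a H1 u" "heap_unfolds body H1 (T @ T1)"
    using IfLe_false.IH(1) IfLe_false.prems by blast
  have T1: "set \<rho> \<subseteq> {..<length (T @ T1)}" "E = map ((!) (T @ T1)) \<rho>"
    using IfLe_false.prems by (auto simp: map_nth_append)
  obtain H2 T2 where 2: "need_eval body H1 \<rho> b H2 w" "heap_unfolds body H2 ((T @ T1) @ T2)"
    using IfLe_false.IH(2)[OF 1(2) T1] by blast
  have T2: "set \<rho> \<subseteq> {..<length ((T @ T1) @ T2)}" "E = map ((!) ((T @ T1) @ T2)) \<rho>"
    using T1(1) T1(2) map_nth_append[OF T1(1), of T2] by (simp_all only: length_append) auto
  obtain H3 T3 where 3: "need_eval body H2 \<rho> d H3 v" "heap_unfolds body H3 (((T @ T1) @ T2) @ T3)"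
    using IfLe_false.IH(3)[OF 2(2) T2] by blast
  show ?case
    using need_eval.IfLe_false[OF 1(1) 2(1) IfLe_false.hyps(3) 3(1)] 3(2) by (metis append_assoc)
next
  case (Call E es v)
  let ?T' = "map (\<lambda>e. Thunk e E) es"
  have len: "length H = length T"
    using Call.prems(1) by (auto simp: heap_unfolds_def dest: list_all2_lengthD)
  have "heap_unfolds body (H @ map (\<lambda>e. Delayed e \<rho>) es) (T @ ?T')"
    using heap_unfolds_alloc Call.prems by blast
  moreover have "set [length H..<length H + length es] \<subseteq> {..<length (T @ ?T')}"
    using len by auto
  \<comment> \<open>The fresh addresses start at \<open>length H = length T\<close>, so they pick
    out exactly the appended thunks.\<close>
  moreover have "?T' = map ((!) (T @ ?T')) [length H..<length H + length es]"
    using len by (intro nth_equalityI) (auto simp: nth_append)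
  ultimately obtain H' T'' where
    "need_eval body (H @ map (\<lambda>e. Delayed e \<rho>) es) [length H..<length H + length es] body H' v"
    "heap_unfolds body H' ((T @ ?T') @ T'')"
    using Call.IH by blast
  then show ?case
    by (metis need_eval.Call append_assoc)
qed

section \<open>The tarai function under call-by-name\<close>

lemma length_sigma [simp]: "length (sigma es) = length es"
  by (cases es) auto

lemma nth_sigma: "j < length es \<Longrightarrow> sigma es ! j = (if j = 0 then Dec (es ! 0) else es ! j)"
  by (cases es) (auto simp: nth_Cons')

text \<open>Positions are counted from 0 here, so \<open>tarai_arg n i\<close> is the expression for \<open>y\<^bsub>i+1\<^esub>\<close>.\<close>

definition tarai_arg :: "nat \<Rightarrow> nat \<Rightarrow> expr" where
  "tarai_arg n i = Call (sigma (rotate i (map Var [0..<n])))"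

lemma tarai_body_eq:
  assumes "n \<ge> 2"
  shows "tarai_body n = IfLe (Var 0) (Var 1) (Var 1) (Call (map (tarai_arg n) [0..<n]))"
proof -
  have "map (\<lambda>i. Call (sigma ((rotate1 ^^ (i - 1)) (map Var [0..<n])))) [1..<n + 1]
      = map (tarai_arg n) [0..<n]"
    by (intro nth_equalityI) (auto simp: tarai_arg_def rotate_def simp del: upt_Suc)
  with assms show ?thesis
    by (simp add: tarai_body_def Let_def)
qed

locale tarai_by_name =
  fixes n :: nat
  assumes n_ge: "n \<ge> 2"
begin

text \<open>Nothing is asked of the values of entries after position \<open>k\<close>: they may
  diverge.\<close>

definition known :: "thunk list \<Rightarrow> nat \<Rightarrow> (nat \<Rightarrow> int) \<Rightarrow> bool" where
  "known E k x \<longleftrightarrow> length E = n \<and> k < n \<and> (\<forall>i\<le>k. forces (tarai_body n) (E ! i) (x i))"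

definition returns :: "thunk list \<Rightarrow> int \<Rightarrow> bool" where
  "returns E v \<longleftrightarrow> name_eval (tarai_body n) E (tarai_body n) v"

text \<open>The environment in which the body runs once \<open>tarai_arg n i\<close> is forced in
  \<open>E\<close>.\<close>

definition inner_args :: "thunk list \<Rightarrow> nat \<Rightarrow> thunk list" where
  "inner_args E i = map (\<lambda>e. Thunk e E) (sigma (rotate i (map Var [0..<n])))"

definition outer_args :: "thunk list \<Rightarrow> thunk list" where
  "outer_args E = map (\<lambda>i. Thunk (tarai_arg n i) E) [0..<n]"

lemma returns_le:
  assumes "known E k x" "k \<ge> 1" "x 0 \<le> x 1"
  shows "returns E (x 1)"
proof -
  have "name_eval (tarai_body n) E (Var 0) (x 0)" "name_eval (tarai_body n) E (Var 1) (x 1)"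
    using assms n_ge by (auto simp: known_def intro!: name_eval_Var)
  then show ?thesis
    using assms(3) unfolding returns_def
    by (subst (2) tarai_body_eq[OF n_ge]) (blast intro: name_eval.IfLe_true)
qed

lemma returns_gt:
  assumes "known E k x" "k \<ge> 1" "x 0 > x 1" "returns (outer_args E) v"
  shows "returns E v"
proof -
  have "name_eval (tarai_body n) E (Var 0) (x 0)" "name_eval (tarai_body n) E (Var 1) (x 1)"
    using assms n_ge by (auto simp: known_def intro!: name_eval_Var)
  moreover have "name_eval (tarai_body n) E (Call (map (tarai_arg n) [0..<n])) v"
    using assms(4) by (intro name_eval.Call) (simp add: returns_def outer_args_def comp_def)
  ultimately show ?thesis
    using assms(3) unfolding returns_def
    by (subst (2) tarai_body_eq[OF n_ge]) (meson name_eval.IfLe_false not_le)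
qed

lemma known_outer_args:
  assumes "k < n" "\<And>i. i \<le> k \<Longrightarrow> returns (inner_args E i) (y i)"
  shows "known (outer_args E) k y"
  using assms
  by (auto simp: known_def returns_def outer_args_def inner_args_def tarai_arg_def
      intro!: name_eval.Call)

text \<open>Rotation by \<open>i\<close> brings entry \<open>(i + j) mod n\<close> of
  \<open>E\<close> to position \<open>j\<close>, and \<open>sigma\<close> changes position 0
  only.\<close>

lemma known_inner_args:
  assumes "length E = n" "k < n"
    and "\<And>j. j \<le> k \<Longrightarrow> forces (tarai_body n) (E ! ((i + j) mod n)) (x j)"
  shows "known (inner_args E i) k (x(0 := x 0 - 1))"
  unfolding known_def
proof (intro conjI allI impI)
  fix j assume "j \<le> k"
  then have j: "j < n" "(i + j) mod n < n" using assms(2) by auto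
  have v: "name_eval (tarai_body n) E (Var ((i + j) mod n)) (x j)"
    using assms(1) assms(3)[OF \<open>j \<le> k\<close>] j(2) by (intro name_eval_Var) auto
  then show "forces (tarai_body n) (inner_args E i ! j) ((x(0 := x 0 - 1)) j)"
    using j by (auto simp: inner_args_def nth_sigma nth_rotate intro: name_eval.Dec)
qed (use assms in \<open>auto simp: inner_args_def\<close>)

lemma known_inner_args_prefix:
  assumes "known E k x" "i \<le> k"
  shows "known (inner_args E i) (k - i) ((\<lambda>j. x (i + j))(0 := x i - 1))"
proof -
  have "known (inner_args E i) (k - i) ((\<lambda>j. x (i + j))(0 := x (i + 0) - 1))"
    using assms by (intro known_inner_args) (auto simp: known_def)
  then show ?thesis by simp
qed

text \<open>The first case of the overview, whose position k is \<open>k + 1\<close> in this count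
  from 0. The inner induction on \<open>x 0 - x 1\<close> serves the inner call
  \<open>i = 0\<close>, where \<open>k\<close> does not decrease.\<close>

lemma returns_at_most_known_max:
  assumes "known E k x" "k \<ge> 1" "x k = M" "\<And>i. i \<le> k \<Longrightarrow> x i \<le> M"
  shows "\<exists>v\<le>M. returns E v"
  using assms
proof (induction k arbitrary: E x rule: less_induct)
  case (less k)
  from less.prems show ?case
  proof (induction "nat (x 0 - x 1)" arbitrary: E x rule: less_induct)
    case (less x E)
    note outer_IH = \<open>\<And>k' E x. k' < k \<Longrightarrow> known E k' x \<Longrightarrow> 1 \<le> k' \<Longrightarrow> x k' = M \<Longrightarrow>
      (\<And>i. i \<le> k' \<Longrightarrow> x i \<le> M) \<Longrightarrow> \<exists>v\<le>M. returns E v\<close>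
    show ?case
    proof (cases "x 0 \<le> x 1")
      case True
      then show ?thesis using returns_le less.prems by blast
    next
      case False
      \<comment> \<open>For \<open>k = 1\<close> the maximum would be \<open>x 1\<close>, and the
        test would succeed.\<close>
      with less.prems(2,3,4) have k: "k \<ge> 2"
        by (metis One_nat_def Suc_1 le_antisym not_less_eq_eq zero_le)
      \<comment> \<open>The known values of inner call \<open>i\<close>. For \<open>i < k\<close>
        the decrement at position 0 spares the maximum, now at \<open>k - i\<close>.\<close>
      define x' where "x' i = (\<lambda>j. x (i + j))(0 := x i - 1)" for i
      have known': "known (inner_args E i) (k - i) (x' i)" if "i < k" for i
        using known_inner_args_prefix[OF less.prems(1), of i] that unfolding x'_def by simp
      have le: "x' i j \<le> M" if "i + j \<le> k" for i j
        using less.prems(4)[of i] less.prems(4)[of "i + j"] that by (auto simp: x'_def)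
      have last: "x' i (k - i) = M" if "i < k" for i
        using less.prems(3) that by (auto simp: x'_def)
      have "\<exists>v\<le>M. returns (inner_args E i) v" if "i < k" for i
      proof (cases "i = 0")
        case True
        have "nat (x' 0 0 - x' 0 1) < nat (x 0 - x 1)"
          using False by (simp add: x'_def)
        then show ?thesis
          using less.hyps[of "x' 0" "inner_args E 0"] known'[of 0] last[of 0] le[of 0] k True by simp
      next
        case False
        then show ?thesis
          using outer_IH[of "k - i", OF _ known'[of i]] last[of i] le[of i] that by auto
      qed
      then obtain y where y: "y i \<le> M" "returns (inner_args E i) (y i)" if "i < k" for i
        by metis
      \<comment> \<open>The first two arguments are \<open>x (k - 1) - 1\<close> and
        \<open>M\<close>, so the test succeeds at once. This moves the maximum of the outer call to
        position \<open>k - 1\<close>.\<close>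
      have "returns (inner_args E (k - 1)) M"
        using returns_le[OF known'[of "k - 1"]] last[of "k - 1"] le[of "k - 1" 0] k by auto
      then have "known (outer_args E) (k - 1) (y(k - 1 := M))"
        using y less.prems(1) k by (intro known_outer_args) (auto simp: known_def)
      moreover have "(y(k - 1 := M)) i \<le> M" if "i \<le> k - 1" for i
        using y(1)[of i] that k by auto
      moreover have "1 \<le> k - 1" "k - 1 < k" using k by simp_all
      ultimately obtain v where "v \<le> M" "returns (outer_args E) v"
        using outer_IH[of "k - 1" "outer_args E" "y(k - 1 := M)"] by auto
      then show ?thesis
        using returns_gt[OF less.prems(1,2)] False by auto
    qed
  qed
qed

text \<open>The bound \<open>M\<close> need not be attained: decrementing \<open>x 0\<close> may
  lower the maximum, while the induction keeps the old one as bound.\<close>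

lemma returns_at_most_upper_bound:
  assumes "known E (n - 1) x" "\<And>i. i < n \<Longrightarrow> x i \<le> M"
  shows "\<exists>v\<le>M. returns E v"
  using assms
proof (induction "nat (x 0 - x 1)" arbitrary: E x M rule: less_induct)
  case (less x E M)
  define m where "m = Max (x ` {..<n})"
  have "m \<in> x ` {..<n}"
    unfolding m_def using n_ge by (intro Max_in) (auto simp: lessThan_empty_iff)
  then obtain p where p: "p < n" "x p = m" by auto
  have le_m: "x i \<le> m" if "i < n" for i
    unfolding m_def using that by auto
  have "m \<le> M" using p less.prems(2) by auto
  have E: "length E = n" "\<And>i. i < n \<Longrightarrow> forces (tarai_body n) (E ! i) (x i)"
    using less.prems(1) by (auto simp: known_def)
  consider "x 0 \<le> x 1" | "p \<ge> 1" | "p = 0" "x 0 > x 1" by linarith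
  then show ?case
  proof cases
    case 1
    then have "returns E (x 1)" using returns_le less.prems(1) n_ge by auto
    then show ?thesis using less.prems(2)[of 1] n_ge by auto
  next
    case 2
    \<comment> \<open>The known prefix is cut off at \<open>p\<close> so that the maximum comes last
      in it.\<close>
    have "known E p x" using E p by (auto simp: known_def)
    then show ?thesis
      using returns_at_most_known_max[of E p x m] 2 p le_m \<open>m \<le> M\<close> by (meson le_less_trans order_trans)
  next
    case 3
    have y0: "\<exists>v\<le>m. returns (inner_args E 0) v"
    proof (rule less.hyps)
      show "known (inner_args E 0) (n - 1) (x(0 := x 0 - 1))"
        using known_inner_args_prefix[OF less.prems(1), of 0] by simp
      show "(x(0 := x 0 - 1)) i \<le> m" if "i < n" for i
        using le_m[of i] that by (auto simp: fun_upd_def)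
    qed (use 3 in auto)
    \<comment> \<open>Now the rotation wraps around: since \<open>(i + (n - i)) mod n = 0\<close>,
      for \<open>1 \<le> i < n\<close> the maximum \<open>x 0\<close> reappears undecremented at
      position \<open>n - i\<close>.\<close>
    define x' where "x' i = (\<lambda>j. x ((i + j) mod n))(0 := x i - 1)" for i
    have known': "known (inner_args E i) (n - i) (x' i)" if "1 \<le> i" "i < n" for i
    proof -
      have "known (inner_args E i) (n - i)
          ((\<lambda>j. x ((i + j) mod n))(0 := x ((i + 0) mod n) - 1))"
        using that E by (intro known_inner_args) auto
      with that show ?thesis by (simp add: x'_def)
    qed
    have le: "x' i j \<le> m" if "i < n" for i j
      using le_m[of i] le_m[of "(i + j) mod n"] that by (auto simp: x'_def)
    have last: "x' i (n - i) = m" if "1 \<le> i" "i < n" for i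
      using that p 3 by (auto simp: x'_def)
    have "\<exists>v\<le>m. returns (inner_args E i) v" if "i < n" for i
    proof (cases "i = 0")
      case False
      then show ?thesis
        using returns_at_most_known_max[OF known'[of i]] last[of i] le[of i] that by auto
    qed (use y0 in simp)
    then obtain y where y: "y i \<le> m" "returns (inner_args E i) (y i)" if "i < n" for i
      by metis
    \<comment> \<open>The first two arguments are \<open>x (n - 1) - 1\<close> and
      \<open>x 0 = m\<close>. The outer call thus has its maximum at \<open>n - 1\<close>, where the
      previous lemma applies.\<close>
    have "returns (inner_args E (n - 1)) m"
      using returns_le[OF known'[of "n - 1"]] last[of "n - 1"] le[of "n - 1" 0] n_ge by auto
    then have "known (outer_args E) (n - 1) (y(n - 1 := m))"
      using y n_ge by (intro known_outer_args) auto
    moreover have "(y(n - 1 := m)) i \<le> m" if "i \<le> n - 1" for i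
      using y(1)[of i] that n_ge by auto
    moreover have "1 \<le> n - 1" using n_ge by simp
    ultimately obtain v where "v \<le> m" "returns (outer_args E) v"
      using returns_at_most_known_max[of "outer_args E" "n - 1" "y(n - 1 := m)" m] by auto
    moreover from this have "returns E v"
      using returns_gt[OF less.prems(1)] 3 n_ge by auto
    ultimately show ?thesis using \<open>m \<le> M\<close> by (meson order_trans)
  qed
qed

end

theorem theorem1p2:
  fixes n :: nat and x :: "int list"
  assumes "n \<ge> 3" and "length x = n"
  shows "tarai_terminates n x \<and> tarai n x \<le> Max (set x)"
proof -
  interpret tarai_by_name n
    using assms(1) by unfold_locales simp
  \<comment> \<open>The arguments of the initial call are numerals, so all \<open>n\<close> entries
    are known.\<close>
  have "known (map (\<lambda>e. Thunk e []) (map Num x)) (n - 1) ((!) x)"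
    using assms by (auto simp: known_def intro: name_eval.Num)
  then obtain v where v: "v \<le> Max (set x)" "returns (map (\<lambda>e. Thunk e []) (map Num x)) v"
    using returns_at_most_upper_bound[of _ "(!) x" "Max (set x)"] assms(2) by auto
  have "name_eval (tarai_body n) [] (Call (map Num x)) v"
    using v(2) unfolding returns_def by (rule name_eval.Call)
  then have "tarai_evaluates_to n x v"
    using need_eval_if_name_eval[of "tarai_body n" "[]" "Call (map Num x)" v "[]" "[]" "[]"]
    by (auto simp: tarai_evaluates_to_def heap_unfolds_def)
  then show ?thesis
    using v(1) tarai_eqI by (auto simp: tarai_terminates_def)
qed

end
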